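(* Let $0=t_0<t_1<\ldots<t_p=M$ be a partition of $[0,M]$ and let $\psi:[0,M)\to\mathbb{R}^2$ be piecewise constant, $\psi(s)=C_i$ if $s\in[t_i,t_{i+1})$, $i=0,\ldots,p-1$, with $C_i\in\mathbb{R}^2$. Let $\tau$ be a transportation cost. Then $$\left|\int_{s_1}^{s_2}\psi\,ds\right|\le\tau(|s_2-s_1|)\quad\forall s_1,s_2\in[0,M]$$ if and only if $$\left|\int_{s_1}^{s_2}\psi\,ds\right|\le\tau(|s_2-s_1|)\quad\forall s_1,s_2\in\{t_0,\ldots,t_p\}.$$
   Context: A transportation cost is a non-decreasing, concave, lower semi-continuous function $\tau:[0,\infty)\to[0,\infty)$ with $\tau(0)=0$. $|\cdot|$ is the Euclidean norm. *)

theory Defs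
  imports "HOL-Analysis.Analysis"
begin

definition lower_semicontinuous_on :: "'a::topological_space set \<Rightarrow> ('a \<Rightarrow> real) \<Rightarrow> bool" where
  "lower_semicontinuous_on S f \<longleftrightarrow>
     (\<forall>x\<in>S. \<forall>y<f x. \<forall>\<^sub>F z in at x within S. y < f z)"

(* A function on [0, \<infinity>) is represented by a total function on the reals;
   nothing is assumed about its values at negative arguments. *)
definition transportation_cost :: "(real \<Rightarrow> real) \<Rightarrow> bool" where
  "transportation_cost \<tau> \<longleftrightarrow>
     \<tau> \<in> {0..} \<rightarrow> {0..} \<and> mono_on {0..} \<tau> \<and> concave_on {0..} \<tau> \<and>
     lower_semicontinuous_on {0..} \<tau> \<and> \<tau> 0 = 0"

end

theory Submission
  imports Defs
begin

text \<open>
  The primitive F of \<open>\<psi>\<close> is affine on every cell of the partition. Fix c and let x run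
  through a segment on which F is affine and which does not contain c in its interior. There
  |F x - F c| is convex in x, whereas \<open>\<tau>\<close>(|x - c|) is concave because |x - c| is affine, so the
  bound holds on the segment once it holds at its two ends. This is applied first with c a
  vertex and then with c arbitrary; if c is interior to the cell of x, the segment
  is the part of the cell on one side of c, and the bound at the end c reads 0 \<open>\<le>\<close> \<open>\<tau>\<close>(0).
\<close>

lemma norm_diff_le_on_segment:
  fixes F :: "real \<Rightarrow> 'a::real_normed_vector" and \<tau> :: "real \<Rightarrow> real"
  assumes conc: "concave_on {0..} \<tau>"
    and aff: "\<And>x. x \<in> {a..b} \<Longrightarrow> F x = F a + (x - a) *\<^sub>R v"
    and c: "c \<le> a \<or> b \<le> c"
    and Fa: "norm (F a - F c) \<le> \<tau> \<bar>a - c\<bar>"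
    and Fb: "norm (F b - F c) \<le> \<tau> \<bar>b - c\<bar>"
    and x: "x \<in> {a..b}"
  shows "norm (F x - F c) \<le> \<tau> \<bar>x - c\<bar>"
proof (cases "a < b")
  case False
  with x have "x = a" by auto
  with Fa show ?thesis by simp
next
  case True
  \<comment> \<open>The barycentric coordinate of x between a and b. As F is affine there,
    \<open>F x - F c\<close> is the combination with the same weights of its values at a and
    b.\<close>
  define u where "u = (x - a) / (b - a)"
  have u: "0 \<le> u" "u \<le> 1" and ux: "u * (b - a) = x - a"
    using x True by (auto simp: u_def field_simps)
  have x_eq: "x = (1 - u) * a + u * b"
    using ux by (simp add: algebra_simps)
  have Fb_eq: "F b = F a + (b - a) *\<^sub>R v"
    using aff[of b] True by simp
  have "F x - F c = (1 - u) *\<^sub>R (F a - F c) + u *\<^sub>R (F b - F c)"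
    unfolding Fb_eq aff[OF x] ux[symmetric] by (simp add: algebra_simps)
  then have "norm (F x - F c) \<le> norm ((1 - u) *\<^sub>R (F a - F c)) + norm (u *\<^sub>R (F b - F c))"
    by (simp only: norm_triangle_ineq)
  also have "\<dots> \<le> (1 - u) * \<tau> \<bar>a - c\<bar> + u * \<tau> \<bar>b - c\<bar>"
    using u Fa Fb by (auto intro!: add_mono mult_left_mono)
  also have "\<dots> \<le> \<tau> ((1 - u) *\<^sub>R \<bar>a - c\<bar> + u *\<^sub>R \<bar>b - c\<bar>)"
    by (rule concave_onD[OF conc]) (use u in auto)
  \<comment> \<open>Since c is not strictly between a and b, the sign of \<open>x - c\<close> does
    not change on the segment, so the absolute value is affine there.\<close>
  also have "(1 - u) *\<^sub>R \<bar>a - c\<bar> + u *\<^sub>R \<bar>b - c\<bar> = \<bar>x - c\<bar>"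
  proof (cases "c \<le> a")
    case True
    with x have "\<bar>a - c\<bar> = a - c" "\<bar>b - c\<bar> = b - c" "\<bar>x - c\<bar> = x - c" by auto
    then show ?thesis by (simp add: x_eq algebra_simps)
  next
    case False
    with c x have "\<bar>a - c\<bar> = c - a" "\<bar>b - c\<bar> = c - b" "\<bar>x - c\<bar> = c - x" by auto
    then show ?thesis by (simp add: x_eq algebra_simps)
  qed
  finally show ?thesis .
qed

text \<open>Induction on the number of cells: a point beyond \<open>t p\<close> is in the last open
  cell or at its right end. The vertices are kept apart from the open cells because the bound is
  given at them.\<close>

lemma partition_cases:
  fixes t :: "nat \<Rightarrow> real"
  assumes "s \<in> {t 0..t p}"
  shows "s \<in> t ` {0..p} \<or> (\<exists>i<p. s \<in> {t i<..<t (Suc i)})"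
  using assms
proof (induction p)
  case 0
  then show ?case by auto
next
  case (Suc p)
  consider "s \<le> t p" | "t p < s" "s < t (Suc p)" | "s = t (Suc p)"
    using Suc.prems by fastforce
  then show ?case
  proof cases
    case 1
    with Suc have "s \<in> t ` {0..p} \<or> (\<exists>i<p. s \<in> {t i<..<t (Suc i)})" by auto
    then show ?thesis using less_SucI by fastforce
  qed auto
qed

lemma partition_mono:
  fixes t :: "nat \<Rightarrow> real"
  assumes "\<And>i. i < p \<Longrightarrow> t i < t (Suc i)" and "i \<le> j" "j \<le> p"
  shows "t i \<le> t j"
  using assms(2,3)
proof (induction j rule: dec_induct)
  case (step n)
  then show ?case using assms(1)[of n] by simp
qed simp

text \<open>The whole argument in terms of the primitive F, with no integrals. Affinity is stated
  between any two points of a cell, not only from its left end, because a segment used in the proof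
  may start at r.\<close>

lemma norm_diff_le_of_partition:
  fixes F :: "real \<Rightarrow> 'a::real_normed_vector" and \<tau> :: "real \<Rightarrow> real" and t :: "nat \<Rightarrow> real"
  assumes conc: "concave_on {0..} \<tau>" and \<tau>0: "\<tau> 0 \<ge> 0"
    and t: "\<And>i. i < p \<Longrightarrow> t i < t (Suc i)"
    and aff: "\<And>i x y. i < p \<Longrightarrow> x \<in> {t i..t (Suc i)} \<Longrightarrow> y \<in> {t i..t (Suc i)}
                \<Longrightarrow> F y = F x + (y - x) *\<^sub>R C i"
    and vert: "\<And>r s. r \<in> t ` {0..p} \<Longrightarrow> s \<in> t ` {0..p} \<Longrightarrow> norm (F s - F r) \<le> \<tau> \<bar>s - r\<bar>"
    and r: "r \<in> {t 0..t p}" and s: "s \<in> {t 0..t p}"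
  shows "norm (F s - F r) \<le> \<tau> \<bar>s - r\<bar>"
proof -
  have vertex: "norm (F y - F c) \<le> \<tau> \<bar>y - c\<bar>"
    if y: "y \<in> {t 0..t p}" and c: "c \<in> t ` {0..p}" for y c
    using partition_cases[OF y]
  proof (elim disjE exE conjE)
    assume "y \<in> t ` {0..p}"
    then show ?thesis using vert c by blast
  next
    fix i assume i: "i < p" and yi: "y \<in> {t i<..<t (Suc i)}"
    obtain k where k: "k \<le> p" "c = t k" using c by auto
    show ?thesis
    proof (rule norm_diff_le_on_segment[OF conc, where a = "t i" and b = "t (Suc i)" and v = "C i"])
      \<comment> \<open>A vertex is never interior to a cell: compare its index k with i.\<close>
      show "c \<le> t i \<or> t (Suc i) \<le> c"
        using k i partition_mono[of p t k i, OF t] partition_mono[of p t "Suc i" k, OF t]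
        by (cases "k \<le> i") auto
    qed (use i yi c in \<open>auto intro!: vert aff\<close>)
  qed
  \<comment> \<open>The two arguments trade places: r becomes the fixed base point, and the bound is
    available at the ends of every cell.\<close>
  have vertex': "norm (F (t i) - F r) \<le> \<tau> \<bar>t i - r\<bar>" if "i \<le> p" for i
    using vertex[OF r, of "t i"] that by (simp add: norm_minus_commute abs_minus_commute)
  show ?thesis
    using partition_cases[OF s]
  proof (elim disjE exE conjE)
    assume "s \<in> t ` {0..p}"
    then show ?thesis using vertex' by auto
  next
    fix i assume i: "i < p" and si: "s \<in> {t i<..<t (Suc i)}"
    have on_segment: ?thesis
      if "{a..b} \<subseteq> {t i..t (Suc i)}" "s \<in> {a..b}" "r \<le> a \<or> b \<le> r"
        "norm (F a - F r) \<le> \<tau> \<bar>a - r\<bar>" "norm (F b - F r) \<le> \<tau> \<bar>b - r\<bar>" for a b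
      by (rule norm_diff_le_on_segment[OF conc, where a = a and b = b and v = "C i"])
        (use i that in \<open>auto intro!: aff\<close>)
    \<comment> \<open>If r lies inside the cell of s, the cell is cut at r and the half containing s
      is kept. At the new end r the bound is \<open>\<tau>0\<close>.\<close>
    consider "r \<le> t i \<or> t (Suc i) \<le> r" | "t i < r" "r < t (Suc i)" "r \<le> s"
      | "t i < r" "r < t (Suc i)" "s \<le> r" by linarith
    then show ?thesis
    proof cases
      case 1
      then show ?thesis using i si vertex'[of i] vertex'[of "Suc i"] by (intro on_segment[of "t i" "t (Suc i)"]) auto
    next
      case 2
      then show ?thesis using i si vertex'[of i] vertex'[of "Suc i"] \<tau>0 by (intro on_segment[of r "t (Suc i)"]) auto
    next
      case 3
      then show ?thesis using i si vertex'[of i] vertex'[of "Suc i"] \<tau>0 by (intro on_segment[of "t i" r]) auto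
    qed
  qed
qed

text \<open>Needed for additivity of the integral. Each bounded cell carries a constant function,
  and the half-open cells are joined one at a time.\<close>

lemma set_integrable_piecewise_constant:
  fixes t :: "nat \<Rightarrow> real" and \<psi> :: "real \<Rightarrow> 'a::{banach, second_countable_topology}"
  assumes t: "\<And>i. i < p \<Longrightarrow> t i < t (Suc i)"
    and \<psi>: "\<And>i s. i < p \<Longrightarrow> s \<in> {t i..<t (Suc i)} \<Longrightarrow> \<psi> s = C i"
  shows "set_integrable lborel {t 0..<t p} \<psi>"
proof -
  have "set_integrable lborel {t 0..<t n} \<psi>" if "n \<le> p" for n
    using that
  proof (induction n)
    case 0
    then show ?case by (simp add: set_integrable_def)
  next
    case (Suc n)
    have "set_integrable lborel {t n..<t (Suc n)} (\<lambda>_. C n)"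
      unfolding set_integrable_def using t[of n] Suc.prems
      by (intro integrable_scaleR_left impI integrable_real_indicator) auto
    also have "?this \<longleftrightarrow> set_integrable lborel {t n..<t (Suc n)} \<psi>"
      using \<psi>[of n] Suc.prems by (intro set_integrable_cong) auto
    finally have "set_integrable lborel ({t 0..<t n} \<union> {t n..<t (Suc n)}) \<psi>"
      using Suc by (intro set_integrable_Un) auto
    moreover have "{t 0..<t n} \<union> {t n..<t (Suc n)} = {t 0..<t (Suc n)}"
      using partition_mono[of p t 0 n, OF t] t[of n] Suc.prems by (intro ivl_disj_un_two) auto
    ultimately show ?case by simp
  qed
  then show ?thesis by simp
qed

theorem theorem3p1:
  fixes M :: real and p :: nat and t :: "nat \<Rightarrow> real"
    and C :: "nat \<Rightarrow> real ^ 2" and \<psi> :: "real \<Rightarrow> real ^ 2" and \<tau> :: "real \<Rightarrow> real"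
  assumes "p \<ge> 1" and "t 0 = 0" and "t p = M"
    and "\<And>i. i < p \<Longrightarrow> t i < t (Suc i)"
    and "\<And>i s. i < p \<Longrightarrow> s \<in> {t i..<t (Suc i)} \<Longrightarrow> \<psi> s = C i"
    and "transportation_cost \<tau>"
  shows "(\<forall>s1\<in>{0..M}. \<forall>s2\<in>{0..M}. norm (LBINT s=ereal s1..ereal s2. \<psi> s) \<le> \<tau> \<bar>s2 - s1\<bar>)
     \<longleftrightarrow> (\<forall>s1\<in>t ` {0..p}. \<forall>s2\<in>t ` {0..p}. norm (LBINT s=ereal s1..ereal s2. \<psi> s) \<le> \<tau> \<bar>s2 - s1\<bar>)"
proof -
  note t = assms(4)
  have mono: "t i \<le> t j" if "i \<le> j" "j \<le> p" for i j
    using partition_mono[of p t i j, OF t] that by auto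
  have vertices: "t ` {0..p} \<subseteq> {0..M}"
    using mono[of 0] mono[of _ p] assms(2,3) by auto
  define F where "F s = (LBINT x=ereal 0..ereal s. \<psi> x)" for s
  \<comment> \<open>The right end is left out because \<psi> is not prescribed at M. Interval
    integrals run over open intervals, so this suffices for all limits in
    \<open>{0..M}\<close>.\<close>
  have int: "set_integrable lborel {0..<M} \<psi>"
    using set_integrable_piecewise_constant[of p t \<psi> C, OF assms(4,5)] assms(2,3) by simp
  have "interval_lebesgue_integrable lborel (ereal a) (ereal b) \<psi>"
    if "a \<in> {0..M}" "b \<in> {0..M}" for a b
    using that unfolding interval_lebesgue_integrable_def
    by (auto intro!: set_integrable_subset[OF int])
  \<comment> \<open>The interval integral is signed, so additivity holds whichever of a and b is
    larger.\<close>
  then have diff: "(LBINT x=ereal a..ereal b. \<psi> x) = F b - F a"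
    if "a \<in> {0..M}" "b \<in> {0..M}" for a b
    unfolding F_def using interval_integral_sum[of "ereal 0" "ereal a" "ereal b" \<psi>] that
    by (simp add: min_def max_def eq_diff_eq add.commute)
  have aff_le: "F y = F x + (y - x) *\<^sub>R C i"
    if "i < p" "t i \<le> x" "x \<le> y" "y \<le> t (Suc i)" for i x y
  proof -
    have "0 \<le> t i" "t (Suc i) \<le> M"
      using mono[of 0 i] mono[of "Suc i" p] assms(2,3) that by auto
    then have "F y - F x = (LBINT s=ereal x..ereal y. \<psi> s)"
      using that by (intro diff[symmetric]) auto
    \<comment> \<open>Agreement on the open interval between x and y is enough, so the value of
      \<psi> at \<open>t (Suc i)\<close> does not matter when y is that point.\<close>
    also have "\<dots> = (LBINT s=ereal x..ereal y. C i)"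
      using that by (intro interval_integral_cong assms(5)) auto
    also have "\<dots> = (y - x) *\<^sub>R C i"
      using that
      by (simp add: interval_lebesgue_integral_def set_lebesgue_integral_def)
    finally show ?thesis by (simp add: algebra_simps)
  qed
  have aff: "F y = F x + (y - x) *\<^sub>R C i"
    if "i < p" "x \<in> {t i..t (Suc i)}" "y \<in> {t i..t (Suc i)}" for i x y
    using aff_le[of i x y] aff_le[of i y x] that
    by (cases "x \<le> y") (auto simp: algebra_simps)
  have conc: "concave_on {0..} \<tau>" and \<tau>0: "\<tau> 0 \<ge> 0"
    using assms(6) by (auto simp: transportation_cost_def)
  show ?thesis (is "?all \<longleftrightarrow> ?vertices")
  proof
    assume ?all
    then show ?vertices using vertices by blast
  next
    assume v: ?vertices
    show ?all
    proof (intro ballI)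
      fix r s assume rs: "r \<in> {0..M}" "s \<in> {0..M}"
      have "norm (F s - F r) \<le> \<tau> \<bar>s - r\<bar>"
      proof (rule norm_diff_le_of_partition[of \<tau> p t F C, OF conc \<tau>0 t aff])
        fix a b assume ab: "a \<in> t ` {0..p}" "b \<in> t ` {0..p}"
        then have "F b - F a = (LBINT x=ereal a..ereal b. \<psi> x)"
          using vertices by (intro diff[symmetric]) auto
        then show "norm (F b - F a) \<le> \<tau> \<bar>b - a\<bar>" using v ab by metis
      qed (use rs assms(2,3) in auto)
      then show "norm (LBINT x=ereal r..ereal s. \<psi> x) \<le> \<tau> \<bar>s - r\<bar>"
        using diff[OF rs] by simp
    qed
  qed
qed

end
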